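(* Let $B$ be an unbalanced bicyclic signed graph of order $n$. Then $\eta(B)\le n-3$, with equality if and only if the underlying graph of $B$ is $\Theta(2,2,1)$ and the two triangles of $B$ are both unbalanced.
   Context: A signed graph $\Gamma=(G,\sigma)$ consists of a finite simple graph $G=(V,E)$ (its underlying graph) and a map $\sigma:E\to\{+,-\}$ (identified with $\{+1,-1\}$). Its order is $|V|$. Its adjacency matrix is the symmetric matrix $A(\Gamma)$ whose $(i,j)$ entry is $\sigma(v_iv_j)$ if $v_iv_j\in E$ and $0$ otherwise. The nullity $\eta(\Gamma)$ is the multiplicity of $0$ as an eigenvalue of $A(\Gamma)$. The sign of a cycle is the product of the signs of its edges; a cycle is balanced (positive) if its sign is $+$ and unbalanced (negative) if its sign is $-$. A signed graph is balanced if all its cycles are positive, and unbalanced otherwise. A bicyclic graph is a connected simple graph $G$ with $|E(G)|=|V(G)|+1$; a bicyclic signed graph is a signed graph whose underlying graph is bicyclic. For $p,q,l\ge 1$, at most one of them equal to $1$, $\Theta(p,q,l)$ denotes the graph that is the union of three internally disjoint paths of lengths (numbers of edges) $p,q,l$ with common end vertices; in particular $\Theta(2,2,1)$ is two triangles sharing exactly one edge. *)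

theory Defs
  imports "Jordan_Normal_Form.Char_Poly"
begin

text \<open>Edges are two-element sets of vertices.\<close>

record 'a ugraph =
  verts :: "'a set"
  edges :: "'a set set"

definition simple_graph :: "('a, 'b) ugraph_scheme \<Rightarrow> bool" where
  "simple_graph G \<longleftrightarrow> finite (verts G) \<and> (\<forall>e\<in>edges G. e \<subseteq> verts G \<and> card e = 2)"

definition is_walk :: "('a, 'b) ugraph_scheme \<Rightarrow> 'a list \<Rightarrow> bool" where
  "is_walk G xs \<longleftrightarrow>
     xs \<noteq> [] \<and> set xs \<subseteq> verts G \<and> successively (\<lambda>x y. {x, y} \<in> edges G) xs"

definition is_path :: "('a, 'b) ugraph_scheme \<Rightarrow> 'a list \<Rightarrow> bool" where
  "is_path G xs \<longleftrightarrow> is_walk G xs \<and> distinct xs"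

definition path_edges :: "'a list \<Rightarrow> 'a set set" where
  "path_edges xs = {{xs ! i, xs ! Suc i} | i. Suc i < length xs}"

definition connected_graph :: "('a, 'b) ugraph_scheme \<Rightarrow> bool" where
  "connected_graph G \<longleftrightarrow>
     verts G \<noteq> {} \<and> (\<forall>u\<in>verts G. \<forall>v\<in>verts G. \<exists>xs. is_walk G xs \<and> hd xs = u \<and> last xs = v)"

text \<open>A cycle is given by the list of its vertices in cyclic order, the starting vertex
  not being repeated at the end; the number of its edges is then the length of the list.\<close>

definition is_cycle :: "('a, 'b) ugraph_scheme \<Rightarrow> 'a list \<Rightarrow> bool" where
  "is_cycle G xs \<longleftrightarrow> is_path G xs \<and> 3 \<le> length xs \<and> {last xs, hd xs} \<in> edges G"

definition cycle_edges :: "'a list \<Rightarrow> 'a set set" where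
  "cycle_edges xs = insert {last xs, hd xs} (path_edges xs)"

definition is_triangle :: "('a, 'b) ugraph_scheme \<Rightarrow> 'a list \<Rightarrow> bool" where
  "is_triangle G xs \<longleftrightarrow> is_cycle G xs \<and> length xs = 3"

definition bicyclic :: "('a, 'b) ugraph_scheme \<Rightarrow> bool" where
  "bicyclic G \<longleftrightarrow> simple_graph G \<and> connected_graph G \<and> card (edges G) = card (verts G) + 1"

text \<open>\<open>is_Theta G p q l\<close>: the graph \<open>G\<close> is (a copy of) \<open>\<Theta>(p, q, l)\<close>. A path with
  \<open>p\<close> edges is a list of \<open>Suc p\<close> vertices.\<close>

definition is_Theta :: "('a, 'b) ugraph_scheme \<Rightarrow> nat \<Rightarrow> nat \<Rightarrow> nat \<Rightarrow> bool" where
  "is_Theta G p q l \<longleftrightarrow>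
     1 \<le> p \<and> 1 \<le> q \<and> 1 \<le> l \<and>
     \<not> (p = 1 \<and> q = 1) \<and> \<not> (p = 1 \<and> l = 1) \<and> \<not> (q = 1 \<and> l = 1) \<and>
     (\<exists>u v P Q L.
        is_path G P \<and> hd P = u \<and> last P = v \<and> length P = Suc p \<and>
        is_path G Q \<and> hd Q = u \<and> last Q = v \<and> length Q = Suc q \<and>
        is_path G L \<and> hd L = u \<and> last L = v \<and> length L = Suc l \<and>
        set P \<inter> set Q = {u, v} \<and> set P \<inter> set L = {u, v} \<and> set Q \<inter> set L = {u, v} \<and>
        verts G = set P \<union> set Q \<union> set L \<and>
        edges G = path_edges P \<union> path_edges Q \<union> path_edges L)"

record 'a signed_graph = "'a ugraph" +
  edge_sign :: "'a set \<Rightarrow> int"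

abbreviation underlying_graph :: "'a signed_graph \<Rightarrow> 'a ugraph" where
  "underlying_graph \<Gamma> \<equiv> ugraph.truncate \<Gamma>"

text \<open>The values of the sign map outside the edge set are irrelevant.\<close>

definition is_signed_graph :: "'a signed_graph \<Rightarrow> bool" where
  "is_signed_graph \<Gamma> \<longleftrightarrow>
     simple_graph (underlying_graph \<Gamma>) \<and> (\<forall>e\<in>edges \<Gamma>. edge_sign \<Gamma> e \<in> {1, - 1})"

definition graph_order :: "('a, 'b) ugraph_scheme \<Rightarrow> nat" where
  "graph_order G = card (verts G)"

definition cycle_sign :: "'a signed_graph \<Rightarrow> 'a list \<Rightarrow> int" where
  "cycle_sign \<Gamma> xs = (\<Prod>e\<in>cycle_edges xs. edge_sign \<Gamma> e)"

definition balanced_cycle :: "'a signed_graph \<Rightarrow> 'a list \<Rightarrow> bool" where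
  "balanced_cycle \<Gamma> xs \<longleftrightarrow> cycle_sign \<Gamma> xs = 1"

definition unbalanced_cycle :: "'a signed_graph \<Rightarrow> 'a list \<Rightarrow> bool" where
  "unbalanced_cycle \<Gamma> xs \<longleftrightarrow> cycle_sign \<Gamma> xs = - 1"

definition balanced :: "'a signed_graph \<Rightarrow> bool" where
  "balanced \<Gamma> \<longleftrightarrow> (\<forall>xs. is_cycle (underlying_graph \<Gamma>) xs \<longrightarrow> balanced_cycle \<Gamma> xs)"

abbreviation unbalanced :: "'a signed_graph \<Rightarrow> bool" where
  "unbalanced \<Gamma> \<equiv> \<not> balanced \<Gamma>"

definition bicyclic_signed_graph :: "'a signed_graph \<Rightarrow> bool" where
  "bicyclic_signed_graph \<Gamma> \<longleftrightarrow> is_signed_graph \<Gamma> \<and> bicyclic (underlying_graph \<Gamma>)"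

definition enumerates :: "'a list \<Rightarrow> 'a set \<Rightarrow> bool" where
  "enumerates vs V \<longleftrightarrow> distinct vs \<and> set vs = V"

text \<open>The adjacency matrix depends on an ordering \<open>vs\<close> of the vertices; the nullity does not,
  see \<open>nullity_eq\<close> below. The multiplicity of \<open>0\<close> as an eigenvalue is its multiplicity as a
  root of the characteristic polynomial.\<close>

definition adjacency_matrix :: "'a signed_graph \<Rightarrow> 'a list \<Rightarrow> real mat" where
  "adjacency_matrix \<Gamma> vs = mat (length vs) (length vs) (\<lambda>(i, j).
     if {vs ! i, vs ! j} \<in> edges \<Gamma> then of_int (edge_sign \<Gamma> {vs ! i, vs ! j}) else 0)"

definition nullity :: "'a signed_graph \<Rightarrow> nat" where
  "nullity \<Gamma> =
     Polynomial.order 0 (char_poly (adjacency_matrix \<Gamma> (SOME vs. enumerates vs (verts \<Gamma>))))"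

lemma sum_delta_nth:
  fixes f :: "nat \<Rightarrow> real"
  assumes "distinct ws" "k < length ws" "x = ws ! k"
  shows "(\<Sum>j = 0..<length ws. (if x = ws ! j then 1 else 0) * f j) = f k"
proof -
  have "(\<Sum>j = 0..<length ws. (if x = ws ! j then 1 else 0) * f j)
      = (\<Sum>j = 0..<length ws. if j = k then f j else 0)"
    using assms by (intro sum.cong) (auto simp: nth_eq_iff_index_eq)
  then show ?thesis using assms by simp
qed

lemma enumeration_change_inverse:
  assumes "enumerates vs V" "enumerates ws V"
  defines "P \<equiv> \<lambda>as bs. mat (length as) (length bs) (\<lambda>(i, j). if as ! i = bs ! j then 1 else 0 :: real)"
  shows "P vs ws * P ws vs = 1\<^sub>m (length vs)"
proof (rule eq_matI)
  fix i j assume "i < dim_row (1\<^sub>m (length vs))" "j < dim_col (1\<^sub>m (length vs))"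
  then have i: "i < length vs" and j: "j < length vs" by auto
  obtain k where k: "k < length ws" "vs ! i = ws ! k"
    using assms(1,2) i unfolding enumerates_def by (metis in_set_conv_nth)
  have "(P vs ws * P ws vs) $$ (i, j)
      = (\<Sum>m = 0..<length ws. (if vs ! i = ws ! m then 1 else 0) * (if ws ! m = vs ! j then 1 else 0))"
    using i j by (simp add: P_def scalar_prod_def)
  also have "\<dots> = (if ws ! k = vs ! j then 1 else 0)"
    by (rule sum_delta_nth) (use assms(2) k in \<open>auto simp: enumerates_def\<close>)
  also have "\<dots> = 1\<^sub>m (length vs) $$ (i, j)"
    using i j k assms(1) by (auto simp: enumerates_def nth_eq_iff_index_eq simp flip: k(2))
  finally show "(P vs ws * P ws vs) $$ (i, j) = 1\<^sub>m (length vs) $$ (i, j)" .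
qed (auto simp: P_def)

lemma adjacency_matrix_similar:
  assumes vs: "enumerates vs V" and ws: "enumerates ws V"
  shows "similar_mat (adjacency_matrix \<Gamma> vs) (adjacency_matrix \<Gamma> ws)"
proof -
  define n where "n = length vs"
  have len: "length ws = n" "length vs = n"
    using vs ws unfolding n_def enumerates_def by (metis distinct_card)+
  define P :: "'a list \<Rightarrow> 'a list \<Rightarrow> real mat" where
    "P as bs = mat (length as) (length bs) (\<lambda>(i, j). if as ! i = bs ! j then 1 else 0)" for as bs
  have PQ: "P vs ws * P ws vs = 1\<^sub>m n" "P ws vs * P vs ws = 1\<^sub>m n"
    using enumeration_change_inverse[OF vs ws] enumeration_change_inverse[OF ws vs] len
    by (simp_all add: P_def)
  have carr: "P vs ws \<in> carrier_mat n n" "P ws vs \<in> carrier_mat n n"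
    "adjacency_matrix \<Gamma> vs \<in> carrier_mat n n" "adjacency_matrix \<Gamma> ws \<in> carrier_mat n n"
    using len by (simp_all add: P_def adjacency_matrix_def)
  define a :: "'a \<Rightarrow> 'a \<Rightarrow> real" where
    "a x y = (if {x, y} \<in> edges \<Gamma> then of_int (edge_sign \<Gamma> {x, y}) else 0)" for x y
  have A: "adjacency_matrix \<Gamma> us = mat (length us) (length us) (\<lambda>(i, j). a (us ! i) (us ! j))" for us
    by (simp add: adjacency_matrix_def a_def)
  have comm: "P vs ws * adjacency_matrix \<Gamma> ws = adjacency_matrix \<Gamma> vs * P vs ws"
  proof (rule eq_matI)
    fix i j assume "i < dim_row (adjacency_matrix \<Gamma> vs * P vs ws)"
      "j < dim_col (adjacency_matrix \<Gamma> vs * P vs ws)"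
    then have i: "i < n" and j: "j < n" using carr by auto
    obtain k where k: "k < n" "vs ! i = ws ! k"
      using vs ws i len unfolding enumerates_def by (metis in_set_conv_nth)
    obtain m where m: "m < n" "ws ! j = vs ! m"
      using vs ws j len unfolding enumerates_def by (metis in_set_conv_nth)
    have "(P vs ws * adjacency_matrix \<Gamma> ws) $$ (i, j)
        = (\<Sum>r = 0..<length ws. (if vs ! i = ws ! r then 1 else 0) * a (ws ! r) (ws ! j))"
      using i j len by (simp add: P_def A scalar_prod_def)
    also have "\<dots> = a (vs ! i) (ws ! j)"
      using sum_delta_nth[of ws k "vs ! i" "\<lambda>r. a (ws ! r) (ws ! j)"] ws k len
      by (simp add: enumerates_def)
    finally have l: "(P vs ws * adjacency_matrix \<Gamma> ws) $$ (i, j) = a (vs ! i) (ws ! j)" .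
    have "(adjacency_matrix \<Gamma> vs * P vs ws) $$ (i, j)
        = (\<Sum>r = 0..<length vs. (if ws ! j = vs ! r then 1 else 0) * a (vs ! i) (vs ! r))"
      using i j len by (auto simp: P_def A scalar_prod_def intro!: sum.cong)
    also have "\<dots> = a (vs ! i) (ws ! j)"
      using sum_delta_nth[of vs m "ws ! j" "\<lambda>r. a (vs ! i) (vs ! r)"] vs m len
      by (simp add: enumerates_def)
    finally show "(P vs ws * adjacency_matrix \<Gamma> ws) $$ (i, j)
        = (adjacency_matrix \<Gamma> vs * P vs ws) $$ (i, j)" using l by simp
  qed (use carr in auto)
  have "adjacency_matrix \<Gamma> vs = adjacency_matrix \<Gamma> vs * (P vs ws * P ws vs)"
    using carr PQ by simp
  also have "\<dots> = P vs ws * adjacency_matrix \<Gamma> ws * P ws vs"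
    using carr by (simp add: comm assoc_mult_mat[of _ n n _ n _ n])
  finally show ?thesis
    by (intro similar_matI[OF _ PQ]) (use carr in auto)
qed

lemma nullity_eq:
  assumes "enumerates vs (verts \<Gamma>)"
  shows "nullity \<Gamma> = Polynomial.order 0 (char_poly (adjacency_matrix \<Gamma> vs))"
proof -
  have "enumerates (SOME us. enumerates us (verts \<Gamma>)) (verts \<Gamma>)"
    using assms by (rule someI)
  then show ?thesis
    unfolding nullity_def using char_poly_similar[OF adjacency_matrix_similar] assms by metis
qed

end

theory Submission
  imports Defs "Jordan_Normal_Form.Schur_Decomposition"
begin

text \<open>The adjacency matrix is symmetric, so \<open>n\<close> minus the nullity is its rank, and a set of
  \<open>k\<close> vertices whose induced subgraph has an invertible adjacency matrix forces nullity at most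
  \<open>n - k\<close>. Suppose that no four vertices do. Then there is no induced path on four vertices,
  no induced triangle with a pendant edge, no induced unbalanced quadrilateral, and no induced
  \<open>\<Theta>(2, 2, 1)\<close> with triangles of opposite signs. Hence every unbalanced cycle of length at least 4
  has a chord that cuts off a shorter unbalanced cycle, and there is an unbalanced triangle, which
  gives the rank 3. A further vertex adjacent to it is adjacent to exactly two of its vertices:
  one is excluded by the pendant edge, three by the number of edges. This yields \<open>\<Theta>(2, 2, 1)\<close> with
  two unbalanced triangles, and the same argument shows that no vertex is left. Conversely, in such
  a graph the rows of the two vertices of degree 2 are proportional.\<close>

section \<open>The multiplicity of the eigenvalue 0 of a symmetric matrix\<close>

text \<open>As \<open>A\<close> is Hermitian, the squared norm of \<open>A v\<close> is the inner
  product of \<open>v\<close> with \<open>A (A v)\<close>, which vanishes. The vector is complex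
  because the Schur form used below is.\<close>

lemma real_symmetric_mult_twice_zero:
  fixes A :: "real mat" and v :: "complex vec"
  assumes A: "A \<in> carrier_mat n n" and sym: "\<And>i j. i < n \<Longrightarrow> j < n \<Longrightarrow> A $$ (i, j) = A $$ (j, i)"
    and v: "v \<in> carrier_vec n"
    and 0: "map_mat complex_of_real A *\<^sub>v (map_mat complex_of_real A *\<^sub>v v) = 0\<^sub>v n"
  shows "map_mat complex_of_real A *\<^sub>v v = 0\<^sub>v n"
proof -
  define u where "u i = (\<Sum>j<n. complex_of_real (A $$ (i, j)) * v $ j)" for i
  have Av: "(map_mat complex_of_real A *\<^sub>v v) $ i = u i" if "i < n" for i
    using that A v by (auto simp: u_def scalar_prod_def atLeast0LessThan intro!: sum.cong)
  have AAv: "(\<Sum>j<n. complex_of_real (A $$ (i, j)) * u j) = 0" if "i < n" for i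
  proof -
    have "(map_mat complex_of_real A *\<^sub>v (map_mat complex_of_real A *\<^sub>v v)) $ i
        = (\<Sum>j<n. complex_of_real (A $$ (i, j)) * (map_mat complex_of_real A *\<^sub>v v) $ j)"
      using that A v by (auto simp: scalar_prod_def atLeast0LessThan intro!: sum.cong)
    then show ?thesis using that Av 0 by simp
  qed
  have "complex_of_real (\<Sum>i<n. (cmod (u i))\<^sup>2) = (\<Sum>i<n. cnj (u i) * u i)"
    by (simp only: of_real_sum complex_norm_square mult.commute)
  also have "\<dots> = (\<Sum>i<n. \<Sum>j<n. cnj (v $ j) * (complex_of_real (A $$ (j, i)) * u i))"
    unfolding u_def[of i for i, THEN arg_cong, of cnj]
    by (auto simp: sum_distrib_right sum_distrib_left sym mult_ac intro!: sum.cong)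
  also have "\<dots> = (\<Sum>j<n. cnj (v $ j) * (\<Sum>i<n. complex_of_real (A $$ (j, i)) * u i))"
    by (subst sum.swap) (simp add: sum_distrib_left)
  also have "\<dots> = 0" using AAv by simp
  finally have "(\<Sum>i<n. (cmod (u i))\<^sup>2) = 0" by (simp only: of_real_eq_0_iff)
  then have "u i = 0" if "i < n" for i
    using that by (subst (asm) sum_nonneg_eq_0_iff) auto
  then show ?thesis using Av A by (intro eq_vecI) auto
qed

text \<open>A Schur form can carry the eigenvalues on its diagonal in any given order; the zeros are
  listed first. The order of the root 0 does not change on passing to complex polynomials.\<close>

lemma complex_char_poly_zeros_first:
  fixes A :: "real mat"
  assumes A: "A \<in> carrier_mat n n"
  obtains es where "char_poly (map_mat complex_of_real A) = (\<Prod>a\<leftarrow>es. [:- a, 1:])" "length es = n"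
    "\<And>i. i < Polynomial.order 0 (char_poly A) \<Longrightarrow> i < n \<and> es ! i = 0"
proof -
  have cA: "map_mat complex_of_real A \<in> carrier_mat n n" using A by simp
  obtain as where as: "char_poly (map_mat complex_of_real A) = (\<Prod>a\<leftarrow>as. [:- a, 1:])" "length as = n"
    using char_poly_factorized[OF cA] by auto
  let ?es = "filter ((=) 0) as @ filter ((\<noteq>) 0) as"
  have prod: "(\<Prod>a\<leftarrow>as. f a) = (\<Prod>a\<leftarrow>?es. f a)" for f :: "complex \<Rightarrow> complex poly"
    by (induction as) (auto simp: mult_ac)
  have len: "length ?es = length as" by (induction as) auto
  interpret of_real: map_poly_inj_idom_divide_hom complex_of_real ..
  have "Polynomial.order 0 (char_poly A) = Polynomial.order 0 (char_poly (map_mat complex_of_real A))"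
    using of_real.order_hom[of 0] by (simp add: of_real_hom.char_poly_hom[OF A])
  also have "\<dots> = (\<Sum>a\<leftarrow>as. Polynomial.order 0 [:- a, 1:])"
    unfolding as by (subst order_prod_list) (auto simp: o_def)
  also have "\<dots> = length (filter ((=) 0) as)"
    by (induction as) (auto simp: order_linear')
  finally have "\<And>i. i < Polynomial.order 0 (char_poly A) \<Longrightarrow> i < n \<and> ?es ! i = 0"
    using as(2) len nth_mem[of _ "filter ((=) 0) as"] length_filter_le[of "(=) 0" as]
    by (fastforce simp: nth_append)
  then show ?thesis using that[of ?es] as prod len by metis
qed

text \<open>For a symmetric matrix the geometric multiplicity of 0 attains the algebraic one: in a
  Schur form with the zeros first, the leading columns vanish, by induction on the column.\<close>

lemma symmetric_schur_zero_columns: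
  fixes A :: "real mat"
  assumes A: "A \<in> carrier_mat n n" and sym: "\<And>i j. i < n \<Longrightarrow> j < n \<Longrightarrow> A $$ (i, j) = A $$ (j, i)"
  obtains B P Q where "similar_mat_wit (map_mat complex_of_real A) B P Q"
    "\<And>j. j < Polynomial.order 0 (char_poly A) \<Longrightarrow> j < n \<and> col B j = 0\<^sub>v n"
proof -
  let ?A = "map_mat complex_of_real A" and ?m = "Polynomial.order 0 (char_poly A)"
  have cA: "?A \<in> carrier_mat n n" using A by simp
  obtain es where es: "char_poly ?A = (\<Prod>a\<leftarrow>es. [:- a, 1:])" "length es = n"
    and es0: "\<And>i. i < ?m \<Longrightarrow> i < n \<and> es ! i = 0"
    using complex_char_poly_zeros_first[OF A] by metis
  obtain B P Q where "schur_decomposition ?A es = (B, P, Q)" by (metis prod_cases3)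
  from schur_decomposition[OF cA es(1) this]
  have wit: "similar_mat_wit ?A B P Q" and ut: "upper_triangular B" and diag: "diag_mat B = es" by auto
  note w = similar_mat_witD2[OF cA wit]
  have B: "B \<in> carrier_mat n n" and P: "P \<in> carrier_mat n n" and Q: "Q \<in> carrier_mat n n" using w by auto
  have mult_zero: "X *\<^sub>v 0\<^sub>v n = 0\<^sub>v n" if "X \<in> carrier_mat n n" for X :: "complex mat"
    using that by (intro eq_vecI) auto
  \<comment> \<open>The kernels of \<open>?A\<close> and of its square agree; the similarity carries
    this over to \<open>B\<close>.\<close>
  have BB: "B *\<^sub>v v = 0\<^sub>v n" if v: "v \<in> carrier_vec n" and 0: "B *\<^sub>v (B *\<^sub>v v) = 0\<^sub>v n" for v
  proof -
    have AP: "?A *\<^sub>v (P *\<^sub>v x) = P *\<^sub>v (B *\<^sub>v x)" if "x \<in> carrier_vec n" for x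
    proof -
      have "?A *\<^sub>v (P *\<^sub>v x) = P *\<^sub>v (B *\<^sub>v ((Q * P) *\<^sub>v x))"
        unfolding w(3) using that B P Q
        by (simp add: assoc_mult_mat_vec[of _ n n _ n])
      then show ?thesis using w(2) that by simp
    qed
    have "?A *\<^sub>v (?A *\<^sub>v (P *\<^sub>v v)) = 0\<^sub>v n"
      using AP[of v] AP[of "B *\<^sub>v v"] 0 v B P by (simp add: mult_zero)
    then have "?A *\<^sub>v (P *\<^sub>v v) = 0\<^sub>v n"
      using real_symmetric_mult_twice_zero[OF A sym] v P by (meson mult_mat_vec_carrier)
    then have "Q *\<^sub>v (P *\<^sub>v (B *\<^sub>v v)) = 0\<^sub>v n" using AP[of v] v Q by (simp add: mult_zero)
    moreover have "Q *\<^sub>v (P *\<^sub>v (B *\<^sub>v v)) = (Q * P) *\<^sub>v (B *\<^sub>v v)"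
      using v P Q B by (simp add: assoc_mult_mat_vec[of _ n n _ n])
    ultimately show ?thesis using w(2) v B by simp
  qed
  have "col B j = 0\<^sub>v n" if "j < ?m" for j
    using that
  proof (induction j rule: less_induct)
    case (less j)
    then have jn: "j < n" using es0 by auto
    have col: "col B k = B *\<^sub>v unit_vec n k" if "k < n" for k
      using that B by (intro eq_vecI) auto
    \<comment> \<open>Every product vanishes: column \<open>k\<close> is zero by induction for
      \<open>k < j\<close>, the diagonal entry is zero for \<open>k = j\<close>, and
      \<open>B\<close> is triangular for \<open>k > j\<close>.\<close>
    have "B *\<^sub>v col B j = 0\<^sub>v n"
    proof (rule eq_vecI)
      fix i assume "i < dim_vec (0\<^sub>v n :: complex vec)"
      then have i: "i < n" by simp
      have "B $$ (i, k) * B $$ (k, j) = 0" if k: "k < n" for k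
      proof (cases k j rule: linorder_cases)
        case less
        then have "col B k = 0\<^sub>v n" using less.IH less.prems by auto
        then have "col B k $ i = 0" using i by simp
        then show ?thesis using i k B by simp
      next
        case equal
        have "B $$ (j, j) = es ! j" using jn B by (auto simp: diag[symmetric] diag_mat_def)
        then show ?thesis using es0[OF less.prems] equal by simp
      next
        case greater
        then show ?thesis using upper_triangularD[OF ut greater] k B by simp
      qed
      then show "(B *\<^sub>v col B j) $ i = 0\<^sub>v n $ i"
        using i jn B by (auto simp: scalar_prod_def intro!: sum.neutral)
    qed (use B in auto)
    then show ?case using BB[of "unit_vec n j"] col[OF jn] by simp
  qed
  then show ?thesis using that[OF wit] es0 by blast
qed

text \<open>The kernel has dimension at least the multiplicity. If that plus \<open>card S\<close>
  exceeded \<open>n\<close>, the kernel would contain a nonzero vector supported on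
  \<open>S\<close>, against \<open>nondeg\<close>.\<close>

lemma order_char_poly_symmetric_le:
  fixes A :: "real mat"
  assumes A: "A \<in> carrier_mat n n" and sym: "\<And>i j. i < n \<Longrightarrow> j < n \<Longrightarrow> A $$ (i, j) = A $$ (j, i)"
    and S: "S \<subseteq> {..<n}"
    and nondeg: "\<And>f i. (\<And>i. i \<in> S \<Longrightarrow> (\<Sum>j\<in>S. complex_of_real (A $$ (i, j)) * f j) = 0) \<Longrightarrow> i \<in> S \<Longrightarrow> f i = 0"
  shows "Polynomial.order 0 (char_poly A) + card S \<le> n"
proof (rule ccontr)
  let ?A = "map_mat complex_of_real A" and ?m = "Polynomial.order 0 (char_poly A)"
  assume neg: "\<not> ?thesis"
  have cA: "?A \<in> carrier_mat n n" using A by simp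
  obtain B P Q where wit: "similar_mat_wit ?A B P Q"
    and zero: "\<And>j. j < ?m \<Longrightarrow> j < n \<and> col B j = 0\<^sub>v n"
    using symmetric_schur_zero_columns[OF A sym] by metis
  note w = similar_mat_witD2[OF cA wit]
  have B: "B \<in> carrier_mat n n" and P: "P \<in> carrier_mat n n" and Q: "Q \<in> carrier_mat n n" using w by auto
  obtain ts where ts: "set ts = {..<n} - S" "distinct ts"
    using finite_distinct_list[of "{..<n} - S"] by auto
  have "length ts = n - card S"
    using ts S distinct_card[of ts] finite_subset[OF S] by (simp add: card_Diff_subset)
  then have len: "length ts < ?m" using neg card_mono[OF _ S] by simp
  text \<open>A kernel vector of \<open>M\<close> is supported on \<open>S\<close> and annihilated by \<open>B * Q\<close>; one of the first
    rows of \<open>M\<close> stays zero, so there is a nonzero one.\<close>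
  define M where "M = mat n n (\<lambda>(i, j). if i < ?m
    then (if i < length ts \<and> ts ! i = j then 1 else 0) else Q $$ (i, j))"
  have M: "M \<in> carrier_mat n n" by (simp add: M_def)
  have "M = mat\<^sub>r n n (\<lambda>i. if i = length ts then 0\<^sub>v n else row M i)"
    using len by (intro eq_matI) (auto simp: M_def)
  moreover have "length ts < n" using zero[OF len] by simp
  moreover have "row M \<in> {0..<n} \<rightarrow> carrier_vec n" using M by auto
  ultimately have "det M = 0" using det_row_0[of "length ts" n "row M"] by metis
  then obtain v where v: "v \<in> carrier_vec n" "v \<noteq> 0\<^sub>v n" "M *\<^sub>v v = 0\<^sub>v n"
    using det_0_iff_vec_prod_zero[OF M] by auto
  have Mv: "(\<Sum>j<n. M $$ (i, j) * v $ j) = 0" if "i < n" for i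
  proof -
    have "(M *\<^sub>v v) $ i = (\<Sum>j<n. M $$ (i, j) * v $ j)"
      using that M v(1) by (auto simp: scalar_prod_def atLeast0LessThan intro!: sum.cong)
    then show ?thesis using v(3) that by simp
  qed
  have outside: "v $ j = 0" if "j < n" "j \<notin> S" for j
  proof -
    have "j \<in> set ts" using ts(1) that by simp
    then obtain i where i: "i < length ts" "ts ! i = j" by (auto simp: in_set_conv_nth)
    then have "i < n" using zero[of i] len by simp
    have "(\<Sum>k<n. M $$ (i, k) * v $ k) = (\<Sum>k<n. if j = k then v $ k else 0)"
      using i len \<open>i < n\<close> by (intro sum.cong) (auto simp: M_def)
    then show ?thesis using Mv[OF \<open>i < n\<close>] that by simp
  qed
  have Qv: "(Q *\<^sub>v v) $ i = 0" if "i < n" "\<not> i < ?m" for i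
    using Mv[OF that(1)] that v Q by (auto simp: M_def scalar_prod_def atLeast0LessThan)
  \<comment> \<open>The zero columns of \<open>B\<close> absorb the first \<open>?m\<close>
    coordinates of \<open>Q v\<close>; the remaining ones vanish by the lower rows of
    \<open>M\<close>.\<close>
  have "B *\<^sub>v (Q *\<^sub>v v) = 0\<^sub>v n"
  proof (rule eq_vecI)
    fix i assume "i < dim_vec (0\<^sub>v n :: complex vec)"
    then have i: "i < n" by simp
    have "B $$ (i, k) * (Q *\<^sub>v v) $ k = 0" if k: "k < n" for k
    proof (cases "k < ?m")
      case True
      then have "col B k $ i = 0" using zero i by simp
      then show ?thesis using i k B by simp
    qed (use Qv k in simp)
    then show "(B *\<^sub>v (Q *\<^sub>v v)) $ i = 0\<^sub>v n $ i"
      using i B Q v by (auto simp: scalar_prod_def[of "row B i"] intro!: sum.neutral)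
  qed (use B in auto)
  then have "?A *\<^sub>v v = 0\<^sub>v n"
    unfolding w(3) using B P Q v by (simp add: assoc_mult_mat_vec[of _ n n _ n]) (auto intro!: eq_vecI)
  have "(\<Sum>j\<in>S. complex_of_real (A $$ (i, j)) * v $ j) = 0" if "i \<in> S" for i
  proof -
    have i: "i < n" using that S by auto
    have "(\<Sum>j\<in>S. complex_of_real (A $$ (i, j)) * v $ j) = (\<Sum>j<n. complex_of_real (A $$ (i, j)) * v $ j)"
      using S outside by (intro sum.mono_neutral_left) auto
    also have "\<dots> = (?A *\<^sub>v v) $ i"
      using i A v by (auto simp: scalar_prod_def atLeast0LessThan intro!: sum.cong)
    finally show ?thesis using \<open>?A *\<^sub>v v = 0\<^sub>v n\<close> i by simp
  qed
  then have "v $ i = 0" if "i \<in> S" for i using nondeg[of "\<lambda>j. v $ j"] that by blast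
  then have "v = 0\<^sub>v n" using outside v(1) by (intro eq_vecI) auto
  then show False using v(2) by simp
qed

section \<open>Signed graphs and induced subgraphs\<close>

text \<open>The adjacency matrix indexed by vertices instead of positions in an enumeration.\<close>

definition signed_adj :: "'a signed_graph \<Rightarrow> 'a \<Rightarrow> 'a \<Rightarrow> int" where
  "signed_adj \<Gamma> x y = (if {x, y} \<in> edges \<Gamma> then edge_sign \<Gamma> {x, y} else 0)"

lemma underlying_graph_sel [simp]:
  "verts (underlying_graph \<Gamma>) = verts \<Gamma>" "edges (underlying_graph \<Gamma>) = edges \<Gamma>"
  by (simp_all add: ugraph.truncate_def)

text \<open>The rank bound rephrased over vertices, which spares the later arguments the
  enumeration: a principal submatrix with trivial kernel bounds the rank from below by its
  size.\<close>

lemma nullity_nondegenerate_subset: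
  assumes fin: "finite (verts \<Gamma>)" and T: "T \<subseteq> verts \<Gamma>"
    and nondeg: "\<And>f x. (\<And>x. x \<in> T \<Longrightarrow> (\<Sum>y\<in>T. of_int (signed_adj \<Gamma> x y) * f y) = (0 :: complex))
      \<Longrightarrow> x \<in> T \<Longrightarrow> f x = 0"
  shows "nullity \<Gamma> + card T \<le> card (verts \<Gamma>)"
proof -
  obtain vs where vs: "set vs = verts \<Gamma>" "distinct vs" using finite_distinct_list[OF fin] by blast
  define S where "S = {i. i < length vs \<and> vs ! i \<in> T}"
  have bij: "bij_betw ((!) vs) S T"
    unfolding bij_betw_def
  proof
    show "inj_on ((!) vs) S" using vs(2) by (auto simp: inj_on_def S_def nth_eq_iff_index_eq)
    show "(!) vs ` S = T"
    proof (intro equalityI subsetI)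
      fix x assume "x \<in> T"
      then have "x \<in> set vs" using T vs(1) by blast
      then show "x \<in> (!) vs ` S" using \<open>x \<in> T\<close> by (auto simp: in_set_conv_nth S_def)
    qed (auto simp: S_def)
  qed
  define A where "A = adjacency_matrix \<Gamma> vs"
  have A: "A \<in> carrier_mat (length vs) (length vs)" by (simp add: A_def adjacency_matrix_def)
  have Aij: "A $$ (i, j) = of_int (signed_adj \<Gamma> (vs ! i) (vs ! j))" if "i < length vs" "j < length vs" for i j
    using that by (simp add: A_def adjacency_matrix_def signed_adj_def)
  have "Polynomial.order 0 (char_poly A) + card S \<le> length vs"
  proof (rule order_char_poly_symmetric_le[OF A])
    fix f :: "nat \<Rightarrow> complex" and i
    assume f: "\<And>i. i \<in> S \<Longrightarrow> (\<Sum>j\<in>S. complex_of_real (A $$ (i, j)) * f j) = 0" and i: "i \<in> S"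
    define g where "g x = f (the_inv_into S ((!) vs) x)" for x
    have g: "g (vs ! j) = f j" if "j \<in> S" for j
      using that bij by (simp add: g_def the_inv_into_f_f bij_betw_def)
    have "(\<Sum>y\<in>T. of_int (signed_adj \<Gamma> (vs ! k) y) * g y) = 0" if "k \<in> S" for k
    proof -
      have "(\<Sum>y\<in>T. of_int (signed_adj \<Gamma> (vs ! k) y) * g y)
          = (\<Sum>j\<in>S. of_int (signed_adj \<Gamma> (vs ! k) (vs ! j)) * g (vs ! j))"
        by (rule sum.reindex_bij_betw[OF bij, symmetric])
      also have "\<dots> = (\<Sum>j\<in>S. complex_of_real (A $$ (k, j)) * f j)"
        using that by (intro sum.cong) (simp_all add: g, simp add: S_def Aij)
      finally show ?thesis using f that by simp
    qed
    then have "(\<Sum>y\<in>T. of_int (signed_adj \<Gamma> x y) * g y) = 0" if "x \<in> T" for x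
      using that bij_betw_imp_surj_on[OF bij] by blast
    moreover have "vs ! i \<in> T" using i by (simp add: S_def)
    ultimately have "g (vs ! i) = 0" by (rule nondeg)
    then show "f i = 0" using g i by simp
  qed (auto simp: S_def Aij signed_adj_def insert_commute)
  moreover have "card S = card T" using bij by (rule bij_betw_same_card)
  moreover have "length vs = card (verts \<Gamma>)" using vs distinct_card by metis
  moreover have "nullity \<Gamma> = Polynomial.order 0 (char_poly A)"
    unfolding A_def by (rule nullity_eq) (use vs in \<open>simp add: enumerates_def\<close>)
  ultimately show ?thesis by simp
qed

text \<open>Cramer's rule for a homogeneous system.\<close>

lemma field_linear_system_2:
  fixes x y z t u v :: "'b :: field"
  assumes "x * u + y * v = 0" "z * u + t * v = 0" "x * t \<noteq> y * z"
  shows "u = 0 \<and> v = 0"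
proof -
  have "(x * t - y * z) * u = t * (x * u + y * v) - y * (z * u + t * v)" by (simp add: algebra_simps)
  then have "(x * t - y * z) * u = 0" unfolding assms(1,2) by simp
  moreover have "(x * t - y * z) * v = x * (z * u + t * v) - z * (x * u + y * v)" by (simp add: algebra_simps)
  then have "(x * t - y * z) * v = 0" unfolding assms(1,2) by simp
  ultimately show ?thesis using assms(3) by simp
qed

section \<open>Small vertex sets with a nonsingular adjacency matrix\<close>

locale signed_graph_on =
  fixes \<Gamma> :: "'a signed_graph" and w :: "'a \<Rightarrow> 'a \<Rightarrow> int"
  assumes signed: "is_signed_graph \<Gamma>"
  defines "w \<equiv> signed_adj \<Gamma>"
begin

lemma finite_verts: "finite (verts \<Gamma>)"
  using signed by (simp add: is_signed_graph_def simple_graph_def)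

lemma w_commute: "w x y = w y x"
  by (simp add: w_def signed_adj_def insert_commute)

lemma w_self [simp]: "w x x = 0"
  using signed by (auto simp: w_def signed_adj_def is_signed_graph_def simple_graph_def)

lemma w_cases: "w x y = 0 \<or> w x y = 1 \<or> w x y = - 1"
  using signed by (auto simp: w_def signed_adj_def is_signed_graph_def)

lemma w_nonzero_iff: "w x y \<noteq> 0 \<longleftrightarrow> {x, y} \<in> edges \<Gamma>"
  using signed by (auto simp: w_def signed_adj_def is_signed_graph_def)

lemma edge_verts: "{x, y} \<in> edges \<Gamma> \<Longrightarrow> x \<in> verts \<Gamma> \<and> y \<in> verts \<Gamma> \<and> x \<noteq> y"
  using signed by (fastforce simp: is_signed_graph_def simple_graph_def)

lemma w_nonzero_verts: "w x y \<noteq> 0 \<Longrightarrow> x \<in> verts \<Gamma> \<and> y \<in> verts \<Gamma> \<and> x \<noteq> y"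
  using edge_verts w_nonzero_iff by blast

text \<open>The determinant of a signed triangle is \<open>2 * w a b * w b c * w a c\<close>,
  nonzero for all signs.\<close>

lemma nullity_triangle:
  assumes "w a b \<noteq> 0" "w b c \<noteq> 0" "w a c \<noteq> 0"
  shows "nullity \<Gamma> + 3 \<le> card (verts \<Gamma>)"
proof -
  have d: "a \<noteq> b" "b \<noteq> c" "a \<noteq> c" using assms w_nonzero_verts by blast+
  have "nullity \<Gamma> + card {a, b, c} \<le> card (verts \<Gamma>)"
  proof (rule nullity_nondegenerate_subset[OF finite_verts])
    fix f :: "'a \<Rightarrow> complex" and x
    assume f: "\<And>x. x \<in> {a, b, c} \<Longrightarrow> (\<Sum>y\<in>{a, b, c}. of_int (signed_adj \<Gamma> x y) * f y) = 0"
      and x: "x \<in> {a, b, c}"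
    have e: "of_int (w a b) * f b + of_int (w a c) * f c = 0"
      "of_int (w a b) * f a + of_int (w b c) * f c = 0"
      "of_int (w a c) * f a + of_int (w b c) * f b = 0"
      using f[of a] f[of b] f[of c] d
      by (simp_all add: w_def[symmetric] w_commute[of b a] w_commute[of c a] w_commute[of c b])
    \<comment> \<open>A combination of the three equations in which \<open>f b\<close> and
      \<open>f c\<close> cancel.\<close>
    have "2 * of_int (w a b * w a c) * f a =
        of_int (w a c) * (of_int (w a b) * f a + of_int (w b c) * f c)
        + of_int (w a b) * (of_int (w a c) * f a + of_int (w b c) * f b)
        - of_int (w b c) * (of_int (w a b) * f b + of_int (w a c) * f c)"
      by (simp add: algebra_simps)
    then have "f a = 0" unfolding e using assms by simp
    then show "f x = 0" using e x assms by auto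
  qed (use assms w_nonzero_verts in blast)
  then show ?thesis using d by simp
qed

text \<open>Spells out the kernel equations on four vertices, so that each shape below becomes an
  explicit homogeneous system.\<close>

lemma nullity_quadruple:
  assumes d: "distinct [a, b, c, d]" and V: "{a, b, c, d} \<subseteq> verts \<Gamma>"
    and nondeg: "\<And>p q r s :: complex.
      of_int (w a b) * q + of_int (w a c) * r + of_int (w a d) * s = 0 \<Longrightarrow>
      of_int (w a b) * p + of_int (w b c) * r + of_int (w b d) * s = 0 \<Longrightarrow>
      of_int (w a c) * p + of_int (w b c) * q + of_int (w c d) * s = 0 \<Longrightarrow>
      of_int (w a d) * p + of_int (w b d) * q + of_int (w c d) * r = 0 \<Longrightarrow>
      p = 0 \<and> q = 0 \<and> r = 0 \<and> s = 0"
  shows "nullity \<Gamma> + 4 \<le> card (verts \<Gamma>)"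
proof -
  have "nullity \<Gamma> + card {a, b, c, d} \<le> card (verts \<Gamma>)"
  proof (rule nullity_nondegenerate_subset[OF finite_verts V])
    fix f :: "'a \<Rightarrow> complex" and x
    assume f: "\<And>x. x \<in> {a, b, c, d} \<Longrightarrow> (\<Sum>y\<in>{a, b, c, d}. of_int (signed_adj \<Gamma> x y) * f y) = 0"
      and x: "x \<in> {a, b, c, d}"
    have "f a = 0 \<and> f b = 0 \<and> f c = 0 \<and> f d = 0"
      by (rule nondeg; use f[of a] f[of b] f[of c] f[of d] d in
          \<open>simp add: w_def[symmetric] w_commute[of b a] w_commute[of c a] w_commute[of c b]
            w_commute[of d a] w_commute[of d b] w_commute[of d c] add.assoc\<close>)
    then show "f x = 0" using x by auto
  qed
  then show ?thesis using d by simp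
qed

text \<open>The equations at the ends \<open>a\<close> and \<open>d\<close> annihilate the inner
  coordinates; those at \<open>b\<close> and \<open>c\<close> then annihilate the outer
  ones.\<close>

lemma nullity_induced_path:
  assumes "distinct [a, b, c, d]" "w a b \<noteq> 0" "w b c \<noteq> 0" "w c d \<noteq> 0"
    "w a c = 0" "w a d = 0" "w b d = 0"
  shows "nullity \<Gamma> + 4 \<le> card (verts \<Gamma>)"
  by (rule nullity_quadruple[OF assms(1)]) (use assms w_nonzero_verts in auto)

text \<open>The equation at the pendant vertex \<open>d\<close> annihilates the coordinate of
  \<open>a\<close>; those at \<open>b\<close> and \<open>c\<close> then annihilate the coordinates
  of \<open>c\<close> and \<open>b\<close>, and the one at \<open>a\<close> that of
  \<open>d\<close>.\<close>

lemma nullity_induced_paw: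
  assumes "w a b \<noteq> 0" "w b c \<noteq> 0" "w a c \<noteq> 0" "w a d \<noteq> 0" "w b d = 0" "w c d = 0"
  shows "nullity \<Gamma> + 4 \<le> card (verts \<Gamma>)"
  by (rule nullity_quadruple[of a b c d])
    (use assms w_nonzero_verts[of a b] w_nonzero_verts[of b c] w_nonzero_verts[of a c]
      w_nonzero_verts[of a d] w_commute[of b c] in auto)

text \<open>For \<open>w a b = 0\<close> this is the case of an induced unbalanced quadrilateral.\<close>

lemma nullity_induced_diamond:
  assumes "distinct [a, b, c, d]" "{a, b, c, d} \<subseteq> verts \<Gamma>"
    "w c d = 0" "w a c * w b d \<noteq> w b c * w a d"
  shows "nullity \<Gamma> + 4 \<le> card (verts \<Gamma>)"
proof (rule nullity_quadruple[OF assms(1,2)])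
  have det: "of_int (w a c) * of_int (w b d) \<noteq> (of_int (w b c) * of_int (w a d) :: complex)"
    using assms(4) by (simp flip: of_int_mult)
  fix p q r s :: complex
  assume e: "of_int (w a b) * q + of_int (w a c) * r + of_int (w a d) * s = 0"
    "of_int (w a b) * p + of_int (w b c) * r + of_int (w b d) * s = 0"
    "of_int (w a c) * p + of_int (w b c) * q + of_int (w c d) * s = 0"
    "of_int (w a d) * p + of_int (w b d) * q + of_int (w c d) * r = 0"
  \<comment> \<open>As \<open>c\<close> and \<open>d\<close> are not adjacent, their equations
    involve only \<open>p\<close> and \<open>q\<close>; once these vanish, the equations at
    \<open>a\<close> and \<open>b\<close> involve only \<open>r\<close> and \<open>s\<close>. The
    two determinants agree.\<close>
  have "p = 0 \<and> q = 0"
    by (rule field_linear_system_2[OF _ _ det]) (use e assms(3) in simp_all)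
  moreover from this have "r = 0 \<and> s = 0"
    using field_linear_system_2[of "of_int (w a c)" r "of_int (w a d)" s "of_int (w b c)" "of_int (w b d)"]
      e det by (simp add: mult.commute)
  ultimately show "p = 0 \<and> q = 0 \<and> r = 0 \<and> s = 0" by simp
qed

end

section \<open>Signs of closed vertex lists and shortening by chords\<close>

fun path_sign :: "('a \<Rightarrow> 'a \<Rightarrow> int) \<Rightarrow> 'a list \<Rightarrow> int" where
  "path_sign w (x # y # zs) = w x y * path_sign w (y # zs)"
| "path_sign w _ = 1"

text \<open>Since \<open>w\<close> is 0 on non-adjacent pairs, the value \<open>- 1\<close> already
  says that consecutive vertices, including last and first, are adjacent. Distinctness and length at
  least 3 then make the list a cycle.\<close>

definition closed_sign :: "('a \<Rightarrow> 'a \<Rightarrow> int) \<Rightarrow> 'a list \<Rightarrow> int" where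
  "closed_sign w xs = path_sign w xs * w (last xs) (hd xs)"

lemma path_edges_simps [simp]:
  "path_edges [] = {}" "path_edges [x] = {}"
  "path_edges (x # y # zs) = insert {x, y} (path_edges (y # zs))"
proof -
  show "path_edges (x # y # zs) = insert {x, y} (path_edges (y # zs))"
  proof (intro equalityI subsetI)
    fix e assume "e \<in> path_edges (x # y # zs)"
    then obtain i where "e = {(x # y # zs) ! i, (x # y # zs) ! Suc i}" "Suc i < length (x # y # zs)"
      by (auto simp: path_edges_def)
    then show "e \<in> insert {x, y} (path_edges (y # zs))"
      by (cases i) (auto simp: path_edges_def)
  next
    fix e assume "e \<in> insert {x, y} (path_edges (y # zs))"
    then consider "e = {x, y}" | i where "e = {(y # zs) ! i, (y # zs) ! Suc i}" "Suc i < length (y # zs)"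
      by (auto simp: path_edges_def)
    then show "e \<in> path_edges (x # y # zs)"
    proof cases
      case 1
      then show ?thesis by (auto simp: path_edges_def intro!: exI[of _ 0])
    next
      case 2
      then show ?thesis by (auto simp: path_edges_def intro!: exI[of _ "Suc i"])
    qed
  qed
qed (auto simp: path_edges_def)

lemma path_edges_subset: "e \<in> path_edges xs \<Longrightarrow> e \<subseteq> set xs"
  by (auto simp: path_edges_def)

lemma finite_path_edges [simp]: "finite (path_edges xs)"
  by (rule finite_subset[of _ "Pow (set xs)"]) (auto dest: path_edges_subset)

lemma int_mult_eq_neg1: "x * y = - 1 \<Longrightarrow> x = - 1 \<or> y = - 1" for x y :: int
  using zmult_eq_1_iff[of "- x" y] by auto

context signed_graph_on
begin

lemma prod_edge_sign_path:
  assumes "distinct xs" "successively (\<lambda>x y. {x, y} \<in> edges \<Gamma>) xs"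
  shows "(\<Prod>e\<in>path_edges xs. edge_sign \<Gamma> e) = path_sign w xs"
  using assms
proof (induction xs rule: induct_list012)
  case (3 x y zs)
  have "{x, y} \<notin> path_edges (y # zs)" using 3(3) by (auto dest: path_edges_subset)
  then show ?case using 3 by (simp add: w_def signed_adj_def)
qed auto

text \<open>\<open>cycle_edges\<close> is a set, so the closing edge must not repeat a path edge;
  length at least 3 ensures this.\<close>

lemma cycle_sign_eq_closed_sign:
  assumes "is_cycle (underlying_graph \<Gamma>) xs"
  shows "cycle_sign \<Gamma> xs = closed_sign w xs"
proof -
  have c: "distinct xs" "successively (\<lambda>x y. {x, y} \<in> edges \<Gamma>) xs" "{last xs, hd xs} \<in> edges \<Gamma>"
    "3 \<le> length xs"
    using assms by (auto simp: is_cycle_def is_path_def is_walk_def)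
  obtain x y z zs where xs: "xs = x # y # z # zs"
    using c(4) by (auto simp: numeral_3_eq_3 Suc_le_length_iff)
  \<comment> \<open>Only \<open>{x, y}\<close> among the path edges contains the first vertex
    \<open>x\<close>, so the closing edge is new once the last vertex differs from
    \<open>y\<close>.\<close>
  have "last (z # zs) \<in> set (z # zs)" by (rule last_in_set) simp
  then have "last (z # zs) \<noteq> y" "last (z # zs) \<noteq> x" using c(1) xs by auto
  then have "{last xs, hd xs} \<notin> path_edges xs"
    using c(1) unfolding xs by (auto simp: doubleton_eq_iff dest!: path_edges_subset)
  then show ?thesis
    using c prod_edge_sign_path[OF c(1,2)]
    by (simp add: cycle_sign_def cycle_edges_def closed_sign_def w_def signed_adj_def)
qed

lemma cycle_sign_cases:
  assumes "is_cycle (underlying_graph \<Gamma>) xs"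
  shows "cycle_sign \<Gamma> xs = 1 \<or> cycle_sign \<Gamma> xs = - 1"
proof -
  have "path_sign w ys = 1 \<or> path_sign w ys = - 1" if "successively (\<lambda>x y. {x, y} \<in> edges \<Gamma>) ys" for ys
    using that
  proof (induction ys rule: induct_list012)
    case (3 x y zs)
    then show ?case using w_cases[of x y] w_nonzero_iff[of x y] by auto
  qed auto
  then show ?thesis
    using assms w_cases[of "last xs" "hd xs"] w_nonzero_iff[of "last xs" "hd xs"]
    unfolding cycle_sign_eq_closed_sign[OF assms]
    by (fastforce simp: closed_sign_def is_cycle_def is_path_def is_walk_def)
qed

text \<open>\<open>p\<close> and \<open>q\<close> are the signs of the two arcs between the ends of
  the chord. The chord lies on both resulting cycles, so the product of their signs is still
  negative.\<close>

lemma chord_splits_sign: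
  assumes "p * q = - 1" "w x y \<noteq> 0"
  shows "p * w x y = - 1 \<or> w x y * q = - 1"
  using w_cases[of x y] int_mult_eq_neg1[OF assms(1)] assms by auto

text \<open>Induction on the length, a chord giving a shorter negative cycle. Length 4 is treated
  apart, since there \<open>a\<close> and \<open>d\<close> are joined by an edge of the cycle
  itself.\<close>

lemma negative_triangle_exists:
  assumes null: "\<not> nullity \<Gamma> + 4 \<le> card (verts \<Gamma>)"
    and "distinct xs" "3 \<le> length xs" "closed_sign w xs = - 1"
  shows "\<exists>a b c. w a b * w b c * w a c = - 1"
  using assms(2-)
proof (induction xs rule: length_induct)
  case (1 xs)
  consider a b c where "xs = [a, b, c]" | a b c d where "xs = [a, b, c, d]"
    | a b c d e ys where "xs = a # b # c # d # e # ys"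
  proof -
    obtain a b c zs where xs: "xs = a # b # c # zs"
      using "1.prems"(2) by (auto simp: numeral_3_eq_3 Suc_le_length_iff)
    show thesis
    proof (cases zs)
      case (Cons d us)
      then show thesis using that xs by (cases us) auto
    qed (use that xs in blast)
  qed
  then show ?case
  proof cases
    case 1
    then show ?thesis using "1.prems" by (auto simp: closed_sign_def w_commute mult.assoc)
  next
    case (2 a b c d)
    have prod: "w b c * w c d * (w a b * w a d) = - 1"
      using "1.prems"(3) by (simp add: 2 closed_sign_def w_commute[of d a] mult_ac)
    then have nz: "w a b \<noteq> 0" "w b c \<noteq> 0" "w c d \<noteq> 0" "w a d \<noteq> 0" by auto
    \<comment> \<open>Only the chord from \<open>b\<close> to \<open>d\<close> is tested: if it is
      missing, the diamond bound applies whether or not \<open>a\<close> and \<open>c\<close> are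
      adjacent.\<close>
    show ?thesis
    proof (cases "w b d = 0")
      case True
      have "w a b * w c d \<noteq> w c b * w a d"
        using prod nz w_cases[of a b] w_cases[of b c] w_cases[of c d] w_cases[of a d] w_commute[of b c] by auto
      moreover have "{a, c, b, d} \<subseteq> verts \<Gamma>" using nz w_nonzero_verts by blast
      ultimately have "nullity \<Gamma> + 4 \<le> card (verts \<Gamma>)"
        using True "1.prems"(1) by (intro nullity_induced_diamond[of a c b d]) (auto simp: 2)
      then show ?thesis using null by simp
    next
      case False
      then have "w b c * w c d * w b d = - 1 \<or> w b d * (w a b * w a d) = - 1"
        using chord_splits_sign[OF prod] by blast
      then show ?thesis by (metis mult.commute mult.left_commute)
    qed
  next
    case (3 a b c d e ys)
    \<comment> \<open>The sign of the arc from \<open>d\<close> back to \<open>a\<close>, untouched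
      by the chords among \<open>a\<close>, \<open>b\<close>, \<open>c\<close>,
      \<open>d\<close>.\<close>
    define t where "t = path_sign w (d # e # ys) * w (last (e # ys)) a"
    have prod: "w a b * w b c * w c d * t = - 1"
      using "1.prems"(3) by (simp add: 3 closed_sign_def t_def mult_ac)
    then have nz: "w a b \<noteq> 0" "w b c \<noteq> 0" "w c d \<noteq> 0" by auto
    note IH = "1.IH"[rule_format, unfolded 3]
    have d: "distinct (a # b # c # d # e # ys)" using "1.prems"(1) 3 by simp
    have "w a c \<noteq> 0 \<or> w b d \<noteq> 0 \<or> w a d \<noteq> 0"
      using nullity_induced_path[of a b c d] null nz d by auto
    then consider "w a c \<noteq> 0" | "w b d \<noteq> 0" | "w a d \<noteq> 0" by blast
    then show ?thesis
    proof cases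
      case 1
      then have "w a b * w b c * w a c = - 1 \<or> w a c * (w c d * t) = - 1"
        using prod by (intro chord_splits_sign) (simp_all add: mult_ac)
      then show ?thesis
        using IH[of "a # c # d # e # ys"] d by (auto simp: closed_sign_def t_def mult_ac)
    next
      case 2
      then have "w b c * w c d * w b d = - 1 \<or> w b d * (w a b * t) = - 1"
        using prod by (intro chord_splits_sign) (simp_all add: mult_ac)
      then show ?thesis
        using IH[of "a # b # d # e # ys"] d by (auto simp: closed_sign_def t_def mult_ac)
    next
      case 3
      then have "w a b * w b c * w c d * w a d = - 1 \<or> w a d * t = - 1"
        using prod by (intro chord_splits_sign) (simp_all add: mult_ac)
      then show ?thesis
        using IH[of "[a, b, c, d]"] IH[of "a # d # e # ys"] d
        by (auto simp: closed_sign_def t_def mult_ac w_commute[of d a])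
    qed
  qed
qed

end

section \<open>Bicyclic graphs\<close>

lemma is_walk_leaves_set:
  assumes "is_walk G xs" "hd xs \<in> S" "last xs \<notin> S"
  shows "\<exists>x\<in>S. \<exists>y\<in>verts G - S. {x, y} \<in> edges G"
  using assms
proof (induction xs rule: induct_list012)
  case (3 x y zs)
  show ?case
  proof (cases "y \<in> S")
    case True
    then show ?thesis using 3 by (auto simp: is_walk_def)
  next
    case False
    then show ?thesis using 3(3,4) by (auto simp: is_walk_def)
  qed
qed (auto simp: is_walk_def)

lemma connected_graph_boundary_edge:
  assumes "connected_graph G" "S \<subseteq> verts G" "S \<noteq> {}" "S \<noteq> verts G"
  obtains x y where "x \<in> S" "y \<in> verts G - S" "{x, y} \<in> edges G"
proof -
  obtain u v where "u \<in> S" "v \<in> verts G - S" using assms by blast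
  moreover from this obtain xs where "is_walk G xs" "hd xs = u" "last xs = v"
    using assms(1,2) unfolding connected_graph_def by blast
  ultimately show ?thesis using is_walk_leaves_set[of G xs S] that by blast
qed

lemma finite_simple_graph_edges:
  assumes "simple_graph G"
  shows "finite (edges G)"
  by (rule finite_subset[of _ "Pow (verts G)"]) (use assms in \<open>auto simp: simple_graph_def\<close>)

text \<open>\<open>S\<close> grows by one vertex at a time along a boundary edge, and every new
  vertex brings at least one new edge.\<close>

lemma card_edges_ge_induced:
  assumes G: "simple_graph G" "connected_graph G" and "S \<subseteq> verts G" "S \<noteq> {}"
  shows "card (edges G \<inter> Pow S) + card (verts G - S) \<le> card (edges G)"
proof -
  have finV: "finite (verts G)" using G(1) by (simp add: simple_graph_def)
  have finE: "finite (edges G)" by (rule finite_simple_graph_edges[OF G(1)])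
  show ?thesis
    using assms(3-)
  proof (induction "card (verts G - S)" arbitrary: S)
    case 0
    have "card (edges G \<inter> Pow S) \<le> card (edges G)" using finE by (intro card_mono) auto
    then show ?case using 0(1) by linarith
  next
    case (Suc k)
    then have "S \<noteq> verts G" by auto
    then obtain x y where xy: "x \<in> S" "y \<in> verts G - S" "{x, y} \<in> edges G"
      using connected_graph_boundary_edge[OF G(2)] Suc.prems by blast
    have "verts G - insert y S = (verts G - S) - {y}" by blast
    then have k: "card (verts G - insert y S) = k"
      using Suc.hyps(2) xy(2) finV by (simp add: card_Diff_singleton)
    have IH: "card (edges G \<inter> Pow (insert y S)) + card (verts G - insert y S) \<le> card (edges G)"
      by (rule Suc.hyps(1)) (use Suc.prems xy(2) k in auto)
    have "insert {x, y} (edges G \<inter> Pow S) \<subseteq> edges G \<inter> Pow (insert y S)" using xy by auto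
    then have "card (insert {x, y} (edges G \<inter> Pow S)) \<le> card (edges G \<inter> Pow (insert y S))"
      using finE by (intro card_mono) auto
    moreover have "card (insert {x, y} (edges G \<inter> Pow S)) = Suc (card (edges G \<inter> Pow S))"
      using finE xy by (intro card_insert_disjoint) auto
    ultimately show ?case using IH k Suc.hyps(2) by linarith
  qed
qed

text \<open>At least as many edges leave \<open>S\<close> or avoid it as there are vertices outside,
  so the excess of edges over vertices on \<open>S\<close> is at most that of the whole
  graph.\<close>

lemma bicyclic_card_edges_le:
  assumes G: "bicyclic G" and S: "S \<subseteq> verts G" "S \<noteq> {}" and F: "F \<subseteq> edges G" "F \<subseteq> Pow S"
  shows "card F \<le> card S + 1"
proof -
  have simple: "simple_graph G" "connected_graph G" using G by (simp_all add: bicyclic_def)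
  then have finV: "finite (verts G)" by (simp add: simple_graph_def)
  have finE: "finite (edges G)" by (rule finite_simple_graph_edges[OF simple(1)])
  have "card F \<le> card (edges G \<inter> Pow S)" using F finE by (intro card_mono) auto
  moreover have "card (verts G - S) = card (verts G) - card S"
    using card_Diff_subset[OF finite_subset[OF S(1) finV] S(1)] .
  moreover have "card S \<le> card (verts G)" using card_mono[OF finV S(1)] .
  moreover have "card (edges G) = card (verts G) + 1" using G by (simp add: bicyclic_def)
  ultimately show ?thesis
    using card_edges_ge_induced[OF simple S] by linarith
qed

section \<open>Bicyclic signed graphs of nullity at least n - 3\<close>

locale bicyclic_signed = signed_graph_on +
  assumes bicyclic: "bicyclic (underlying_graph \<Gamma>)"
begin

lemma connected: "connected_graph (underlying_graph \<Gamma>)"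
  using bicyclic by (simp add: bicyclic_def)

lemma card_edges: "card (edges \<Gamma>) = card (verts \<Gamma>) + 1"
  using bicyclic by (simp add: bicyclic_def)

lemma finite_edges: "finite (edges \<Gamma>)"
  by (rule card_ge_0_finite) (simp add: card_edges)

lemma boundary_edge:
  assumes "S \<subseteq> verts \<Gamma>" "S \<noteq> {}" "S \<noteq> verts \<Gamma>"
  obtains x y where "x \<in> S" "y \<in> verts \<Gamma> - S" "w x y \<noteq> 0"
proof -
  obtain x y where "x \<in> S" "y \<in> verts \<Gamma> - S" "{x, y} \<in> edges \<Gamma>"
    using connected_graph_boundary_edge[OF connected, of S] assms by auto
  then show thesis using that w_nonzero_iff by simp
qed

lemma card_edges_le:
  assumes "S \<subseteq> verts \<Gamma>" "S \<noteq> {}" "F \<subseteq> edges \<Gamma>" "F \<subseteq> Pow S"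
  shows "card F \<le> card S + 1"
  using bicyclic_card_edges_le[OF bicyclic, of S F] assms by simp

lemma edge_within:
  assumes "e \<in> edges \<Gamma>"
  obtains x y where "e = {x, y}" "x \<in> verts \<Gamma>" "y \<in> verts \<Gamma>" "x \<noteq> y"
proof -
  have "e \<subseteq> verts \<Gamma>" "card e = 2"
    using assms signed by (auto simp: is_signed_graph_def simple_graph_def)
  then show thesis using that by (auto simp: card_2_iff)
qed

text \<open>With \<open>a\<close> as the only neighbour the four vertices would induce a paw; with
  three neighbours they would carry six edges, against the bound of five.\<close>

lemma neighbour_of_triangle_meets_two:
  assumes null: "\<not> nullity \<Gamma> + 4 \<le> card (verts \<Gamma>)"
    and abc: "w a b \<noteq> 0" "w b c \<noteq> 0" "w a c \<noteq> 0"
    and x: "x \<notin> {a, b, c}" "w x a \<noteq> 0"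
  shows "(w x b \<noteq> 0) \<noteq> (w x c \<noteq> 0)"
proof
  assume "(w x b \<noteq> 0) = (w x c \<noteq> 0)"
  then consider "w x b = 0" "w x c = 0" | "w x b \<noteq> 0" "w x c \<noteq> 0" by blast
  then show False
  proof cases
    case 1
    then show False
      using nullity_induced_paw[of a b c x] abc x null by (auto simp: w_commute[of _ x])
  next
    case 2
    have d: "distinct [a, b, c, x]" using abc[THEN w_nonzero_verts] x by auto
    have "card {{a, b}, {a, c}, {b, c}, {x, a}, {x, b}, {x, c}} \<le> card {a, b, c, x} + 1"
      by (rule card_edges_le) (use abc abc[THEN w_nonzero_verts] x 2 w_nonzero_verts[of x a] in \<open>auto simp flip: w_nonzero_iff\<close>)
    moreover have "card {{a, b}, {a, c}, {b, c}, {x, a}, {x, b}, {x, c}} = 6"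
      using d by (simp add: doubleton_eq_iff)
    ultimately show False using d by simp
  qed
qed

text \<open>Each vertex of the diamond lies on a triangle, so a fifth vertex adjacent to the diamond
  has two neighbours in it; five vertices would then carry seven edges, one too many.\<close>

lemma diamond_exhausts_graph:
  assumes null: "\<not> nullity \<Gamma> + 4 \<le> card (verts \<Gamma>)"
    and d: "distinct [p, q, r, x]"
    and e: "w p q \<noteq> 0" "w p r \<noteq> 0" "w q r \<noteq> 0" "w p x \<noteq> 0" "w q x \<noteq> 0"
  shows "verts \<Gamma> = {p, q, r, x}" "edges \<Gamma> = {{p, q}, {p, r}, {q, r}, {p, x}, {q, x}}"
proof -
  let ?S = "{p, q, r, x}" and ?E = "{{p, q}, {p, r}, {q, r}, {p, x}, {q, x}}"
  have S: "?S \<subseteq> verts \<Gamma>" using e[THEN w_nonzero_verts] by auto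
  have E: "?E \<subseteq> edges \<Gamma>" using e by (simp add: w_nonzero_iff)
  have cE: "card ?E = 5" using d by (simp add: doubleton_eq_iff)
  show V: "verts \<Gamma> = ?S"
  proof (rule ccontr)
    assume "verts \<Gamma> \<noteq> ?S"
    then obtain z y where zy: "z \<in> ?S" "y \<in> verts \<Gamma> - ?S" "w z y \<noteq> 0"
      using boundary_edge[OF S] by blast
    have tri: "\<exists>z'\<in>?S. z' \<noteq> z \<and> w y z' \<noteq> 0"
      if "w z b \<noteq> 0" "w b c \<noteq> 0" "w z c \<noteq> 0" "b \<in> ?S" "c \<in> ?S" for b c
    proof -
      have "w y z \<noteq> 0" "y \<notin> {z, b, c}" using zy that(4,5) w_commute[of y z] by auto
      then have "w y b \<noteq> 0 \<or> w y c \<noteq> 0"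
        using neighbour_of_triangle_meets_two[OF null that(1-3), of y] by blast
      moreover have "b \<noteq> z" "c \<noteq> z" using that(1,3) by auto
      ultimately show ?thesis using that(4,5) by blast
    qed
    have "\<exists>z'\<in>?S. z' \<noteq> z \<and> w y z' \<noteq> 0"
    proof -
      note comm = w_commute[of q p] w_commute[of r p] w_commute[of r q] w_commute[of x p] w_commute[of x q]
      consider "z = p" | "z = q" | "z = r" | "z = x" using zy(1) by blast
      then show ?thesis
      proof cases
        case 1
        show ?thesis by (rule tri[of q r]) (use 1 e in simp_all)
      next
        case 2
        show ?thesis by (rule tri[of p r]) (use 2 e in \<open>simp_all add: comm\<close>)
      next
        case 3
        show ?thesis by (rule tri[of p q]) (use 3 e in \<open>simp_all add: comm\<close>)
      next
        case 4
        show ?thesis by (rule tri[of p q]) (use 4 e in \<open>simp_all add: comm\<close>)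
      qed
    qed
    then obtain z' where z': "z' \<in> ?S" "z' \<noteq> z" "w y z' \<noteq> 0" by blast
    have "card (insert {y, z} (insert {y, z'} ?E)) \<le> card (insert y ?S) + 1"
    proof (rule card_edges_le)
      show "insert {y, z} (insert {y, z'} ?E) \<subseteq> edges \<Gamma>"
        using E zy(3) z'(3) w_nonzero_iff[of y z] w_nonzero_iff[of y z'] w_commute[of z y] by simp
    qed (use S zy z' in auto)
    moreover have "{y, z} \<notin> insert {y, z'} ?E" "{y, z'} \<notin> ?E"
      using zy z' by (auto simp: doubleton_eq_iff)
    then have "card (insert {y, z} (insert {y, z'} ?E)) = 7" using cE by simp
    ultimately show False using zy(2) d by simp
  qed
  have "card (edges \<Gamma>) = 5" using card_edges V d by simp
  then show "edges \<Gamma> = ?E" using card_subset_eq[OF finite_edges E] cE by simp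
qed

lemma obtain_negative_diamond:
  assumes null: "\<not> nullity \<Gamma> + 4 \<le> card (verts \<Gamma>)" and tri: "w a b * w b c * w a c = - 1"
  obtains p q r x where "distinct [p, q, r, x]" "w p q * w p r * w q r = - 1" "w p q * w p x * w q x = - 1"
proof -
  have nz: "w a b \<noteq> 0" "w b c \<noteq> 0" "w a c \<noteq> 0" using tri by auto
  have d: "distinct [a, b, c]" and T: "{a, b, c} \<subseteq> verts \<Gamma>"
    using nz[THEN w_nonzero_verts] by simp_all
  \<comment> \<open>A bicyclic graph on three vertices would need four edges.\<close>
  have "verts \<Gamma> \<noteq> {a, b, c}"
  proof
    assume V: "verts \<Gamma> = {a, b, c}"
    have "edges \<Gamma> \<subseteq> {{a, b}, {a, c}, {b, c}}"
    proof
      fix e assume "e \<in> edges \<Gamma>"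
      then obtain u v where e: "e = {u, v}" "u \<in> verts \<Gamma>" "v \<in> verts \<Gamma>" "u \<noteq> v"
        by (rule edge_within)
      then have "u \<in> {a, b, c}" "v \<in> {a, b, c}" using V by simp_all
      then show "e \<in> {{a, b}, {a, c}, {b, c}}"
        using e(4) unfolding e(1) by (auto simp: doubleton_eq_iff)
    qed
    then have "card (edges \<Gamma>) \<le> card {{a, b}, {a, c}, {b, c}}" by (intro card_mono) auto
    also have "\<dots> \<le> 3" using card_length[of "[{a, b}, {a, c}, {b, c}]"] by simp
    finally show False using card_edges V d by simp
  qed
  then obtain z y where zy: "z \<in> {a, b, c}" "y \<in> verts \<Gamma> - {a, b, c}" "w z y \<noteq> 0"
    using boundary_edge[OF T] by blast
  note conclude = that
  \<comment> \<open>\<open>p\<close> and \<open>q\<close> are the two neighbours of \<open>y\<close>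
    on the triangle. The diamond must be singular, so \<open>w p r * w q y = w q r * w p y\<close>,
    which makes the two triangle signs equal.\<close>
  have step: thesis
    if tri: "w p q * w p r * w q r = - 1" and dist: "distinct [p, q, r, y]"
      and e: "w p y \<noteq> 0" "w q y \<noteq> 0" "w r y = 0" for p q r
  proof -
    have nz: "w p q \<noteq> 0" "w p r \<noteq> 0" "w q r \<noteq> 0" using tri by auto
    then have "{p, q, r, y} \<subseteq> verts \<Gamma>" using zy(2) nz[THEN w_nonzero_verts] by auto
    then have "w p r * w q y = w q r * w p y"
      using nullity_induced_diamond[OF dist] null e(3) by blast
    then have "w p q * w p y * w q y = - 1"
      using tri nz e w_cases[of p q] w_cases[of p r] w_cases[of q r] w_cases[of p y] w_cases[of q y] by auto
    then show thesis using conclude dist tri by blast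
  qed
  note comm = w_commute[of b a] w_commute[of c a] w_commute[of c b] w_commute[of y]
  have y: "y \<notin> {a, b, c}" "y \<notin> {b, a, c}" "y \<notin> {c, a, b}" "a \<noteq> y" "b \<noteq> y" "c \<noteq> y" using zy(2) by auto
  \<comment> \<open>One ordering of the triangle for each pair of its vertices that can be joined to
    \<open>y\<close>.\<close>
  have tris: "w a b * w a c * w b c = - 1" "w a c * w a b * w c b = - 1" "w b c * w b a * w c a = - 1"
    using tri by (simp_all add: comm mult_ac)
  consider "w a y \<noteq> 0" | "w b y \<noteq> 0" | "w c y \<noteq> 0" using zy by auto
  then have "(w a y \<noteq> 0 \<and> w b y \<noteq> 0 \<and> w c y = 0) \<or> (w a y \<noteq> 0 \<and> w c y \<noteq> 0 \<and> w b y = 0)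
      \<or> (w b y \<noteq> 0 \<and> w c y \<noteq> 0 \<and> w a y = 0)"
  proof cases
    case 1
    then show ?thesis
      using neighbour_of_triangle_meets_two[OF null, of a b c y] nz y by (auto simp: comm)
  next
    case 2
    then show ?thesis
      using neighbour_of_triangle_meets_two[OF null, of b a c y] nz y by (auto simp: comm)
  next
    case 3
    then show ?thesis
      using neighbour_of_triangle_meets_two[OF null, of c a b y] nz y by (auto simp: comm)
  qed
  then show thesis
    using step[OF tris(1)] step[OF tris(2)] step[OF tris(3)] d y by auto
qed

end

section \<open>The graph Theta(2, 2, 1), its triangles and its nullity\<close>

lemma is_Theta_221I:
  assumes "distinct [p, q, r, x]" "verts G = {p, q, r, x}"
    "edges G = {{p, q}, {p, r}, {q, r}, {p, x}, {q, x}}"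
  shows "is_Theta G 2 2 1"
  unfolding is_Theta_def
proof (intro conjI)
  show "\<exists>u v P Q L.
        is_path G P \<and> hd P = u \<and> last P = v \<and> length P = Suc 2 \<and>
        is_path G Q \<and> hd Q = u \<and> last Q = v \<and> length Q = Suc 2 \<and>
        is_path G L \<and> hd L = u \<and> last L = v \<and> length L = Suc 1 \<and>
        set P \<inter> set Q = {u, v} \<and> set P \<inter> set L = {u, v} \<and> set Q \<inter> set L = {u, v} \<and>
        verts G = set P \<union> set Q \<union> set L \<and>
        edges G = path_edges P \<union> path_edges Q \<union> path_edges L"
    by (rule exI[of _ p], rule exI[of _ q], rule exI[of _ "[p, r, q]"], rule exI[of _ "[p, x, q]"],
        rule exI[of _ "[p, q]"]) (use assms in \<open>auto simp: is_path_def is_walk_def insert_commute\<close>)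
qed auto

text \<open>\<open>p\<close> and \<open>q\<close> are the ends of the shared edge, \<open>r\<close>
  and \<open>x\<close> the midpoints of the two paths of length 2.\<close>

lemma is_Theta_221E:
  assumes "is_Theta G 2 2 1"
  obtains p q r x where "distinct [p, q, r, x]" "verts G = {p, q, r, x}"
    "edges G = {{p, q}, {p, r}, {q, r}, {p, x}, {q, x}}"
proof -
  obtain p q P Q L where
    P: "is_path G P" "hd P = p" "last P = q" "length P = Suc 2" and
    Q: "is_path G Q" "hd Q = p" "last Q = q" "length Q = Suc 2" and
    L: "is_path G L" "hd L = p" "last L = q" "length L = Suc 1" and
    PQ: "set P \<inter> set Q = {p, q}" and
    V: "verts G = set P \<union> set Q \<union> set L" and
    E: "edges G = path_edges P \<union> path_edges Q \<union> path_edges L"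
    using assms unfolding is_Theta_def by metis
  obtain r where r: "P = [p, r, q]" using P by (auto simp: length_Suc_conv numeral_2_eq_2)
  obtain x where x: "Q = [p, x, q]" using Q by (auto simp: length_Suc_conv numeral_2_eq_2)
  have l: "L = [p, q]" using L by (auto simp: length_Suc_conv)
  show thesis
  proof (rule that)
    show "distinct [p, q, r, x]" using P(1) Q(1) PQ by (auto simp: is_path_def r x)
    show "verts G = {p, q, r, x}" using V by (auto simp: r x l)
    show "edges G = {{p, q}, {p, r}, {q, r}, {p, x}, {q, x}}"
      unfolding E by (auto simp: r x l insert_commute)
  qed
qed

context signed_graph_on
begin

lemma is_triangle_iff:
  "is_triangle (underlying_graph \<Gamma>) xs \<longleftrightarrow> (\<exists>a b c. xs = [a, b, c] \<and> w a b \<noteq> 0 \<and> w b c \<noteq> 0 \<and> w a c \<noteq> 0)"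
proof
  assume "is_triangle (underlying_graph \<Gamma>) xs"
  then show "\<exists>a b c. xs = [a, b, c] \<and> w a b \<noteq> 0 \<and> w b c \<noteq> 0 \<and> w a c \<noteq> 0"
    by (auto simp: is_triangle_def is_cycle_def is_path_def is_walk_def length_Suc_conv numeral_3_eq_3
        w_nonzero_iff insert_commute)
next
  assume "\<exists>a b c. xs = [a, b, c] \<and> w a b \<noteq> 0 \<and> w b c \<noteq> 0 \<and> w a c \<noteq> 0"
  then obtain a b c where abc: "xs = [a, b, c]" "{a, b} \<in> edges \<Gamma>" "{b, c} \<in> edges \<Gamma>" "{a, c} \<in> edges \<Gamma>"
    using w_nonzero_iff by blast
  then show "is_triangle (underlying_graph \<Gamma>) xs"
    using edge_verts[of a b] edge_verts[of b c] edge_verts[of a c]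
    by (auto simp: is_triangle_def is_cycle_def is_path_def is_walk_def insert_commute)
qed

lemma cycle_sign_triangle:
  assumes "w a b \<noteq> 0" "w b c \<noteq> 0" "w a c \<noteq> 0"
  shows "cycle_sign \<Gamma> [a, b, c] = w a b * w b c * w a c"
proof -
  have "is_cycle (underlying_graph \<Gamma>) [a, b, c]"
    using assms is_triangle_iff[of "[a, b, c]"] by (simp add: is_triangle_def)
  then show ?thesis
    by (simp add: cycle_sign_eq_closed_sign closed_sign_def w_commute[of c a])
qed

text \<open>As \<open>r\<close> and \<open>x\<close> are not adjacent, a triangle omits one of them
  and so is, up to order, one of the two given ones.\<close>

lemma diamond_triangles_negative:
  assumes V: "verts \<Gamma> = {p, q, r, x}" and rx: "w r x = 0"
    and neg: "w p q * w p r * w q r = - 1" "w p q * w p x * w q x = - 1"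
    and xs: "is_triangle (underlying_graph \<Gamma>) xs"
  shows "unbalanced_cycle \<Gamma> xs"
proof -
  obtain a b c where abc: "xs = [a, b, c]" "w a b \<noteq> 0" "w b c \<noteq> 0" "w a c \<noteq> 0"
    using xs is_triangle_iff by blast
  have mem: "a \<in> {p, q, r, x}" "b \<in> {p, q, r, x}" "c \<in> {p, q, r, x}"
    using abc(2-4)[THEN w_nonzero_verts] V by auto
  have comm: "w q p = w p q" "w r p = w p r" "w r q = w q r" "w x p = w p x" "w x q = w q x" "w x r = 0"
    using w_commute rx by metis+
  have "w a b * w b c * w a c = - 1"
    using mem abc(2-4) neg rx by (elim insertE emptyE) (simp_all add: comm mult_ac)
  then show ?thesis using cycle_sign_triangle abc by (simp add: unbalanced_cycle_def)
qed

text \<open>By \<open>rx\<close> and \<open>eq\<close> the columns of \<open>r\<close> and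
  \<open>x\<close> are proportional, so the matrix is singular.\<close>

lemma nullity_diamond_pos:
  assumes d: "distinct [p, q, r, x]" and V: "verts \<Gamma> = {p, q, r, x}" and rx: "w r x = 0"
    and px: "w p x \<noteq> 0" and eq: "w p r * w q x = w q r * w p x"
  shows "1 \<le> nullity \<Gamma>"
proof -
  define A where "A = adjacency_matrix \<Gamma> [p, q, r, x]"
  have A: "A \<in> carrier_mat 4 4" by (simp add: A_def adjacency_matrix_def carrier_matI)
  have Aij: "A $$ (i, j) = of_int (w ([p, q, r, x] ! i) ([p, q, r, x] ! j))" if "i < 4" "j < 4" for i j
  proof -
    have "i < length [p, q, r, x]" "j < length [p, q, r, x]" using that by simp_all
    then show ?thesis unfolding A_def adjacency_matrix_def w_def signed_adj_def by (subst index_mat) simp_all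
  qed
  \<comment> \<open>Encodes \<open>w p x\<close> times the column of \<open>r\<close> minus
    \<open>w p r\<close> times the column of \<open>x\<close>; nonzero by \<open>px\<close>.\<close>
  define v :: "real vec" where
    "v = vec 4 (\<lambda>i. if i = 2 then of_int (w p x) else if i = 3 then - of_int (w p r) else 0)"
  have v: "v \<in> carrier_vec 4" by (simp add: v_def)
  have v_nth: "v $ 0 = 0" "v $ 1 = 0" "v $ 2 = of_int (w p x)" "v $ 3 = - of_int (w p r)"
    by (simp_all add: v_def)
  have sum4: "(\<Sum>j<4. g j) = g 0 + g 1 + g 2 + g 3" for g :: "nat \<Rightarrow> real"
    by (simp add: eval_nat_numeral)
  have "A *\<^sub>v v = 0\<^sub>v 4"
  proof (rule eq_vecI)
    fix i assume "i < dim_vec (0\<^sub>v 4 :: real vec)"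
    then have i: "i < 4" by simp
    have "(A *\<^sub>v v) $ i = (\<Sum>j<4. A $$ (i, j) * v $ j)"
      using i A v by (auto simp: scalar_prod_def atLeast0LessThan intro!: sum.cong)
    also have "\<dots> = A $$ (i, 2) * of_int (w p x) - A $$ (i, 3) * of_int (w p r)"
      unfolding sum4 v_nth by simp
    also have "\<dots> = of_int (w ([p, q, r, x] ! i) r * w p x - w ([p, q, r, x] ! i) x * w p r)"
      using i by (simp add: Aij)
    also have "w ([p, q, r, x] ! i) r * w p x - w ([p, q, r, x] ! i) x * w p r = 0"
    proof -
      consider "i = 0" | "i = 1" | "i = 2" | "i = 3" using i by linarith
      then show ?thesis using eq rx w_commute[of x r] by cases (simp_all add: mult.commute)
    qed
    finally show "(A *\<^sub>v v) $ i = 0\<^sub>v 4 $ i" using i by simp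
  qed (use A in auto)
  moreover have "v \<noteq> 0\<^sub>v 4"
  proof
    assume "v = 0\<^sub>v 4"
    then have "v $ 2 = 0" by simp
    then show False using v_nth(3) px by simp
  qed
  ultimately have "eigenvalue A 0"
    using A v unfolding eigenvalue_def eigenvector_def by (intro exI[of _ v]) auto
  then have "poly (char_poly A) 0 = 0" using eigenvalue_root_char_poly[OF A] by simp
  moreover have "char_poly A \<noteq> 0" using degree_monic_char_poly[OF A] by auto
  ultimately have "Polynomial.order 0 (char_poly A) \<noteq> 0" using order_root by blast
  moreover have "nullity \<Gamma> = Polynomial.order 0 (char_poly A)"
    unfolding A_def by (rule nullity_eq) (use d V in \<open>auto simp: enumerates_def\<close>)
  ultimately show ?thesis by simp
qed

end

theorem theorem3p1:
  fixes B :: "'a signed_graph" and n :: nat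
  assumes "bicyclic_signed_graph B"
    and "unbalanced B"
    and "graph_order B = n"
  shows "int (nullity B) \<le> int n - 3 \<and>
    (int (nullity B) = int n - 3 \<longleftrightarrow>
       is_Theta (underlying_graph B) 2 2 1 \<and>
       (\<forall>xs. is_triangle (underlying_graph B) xs \<longrightarrow> unbalanced_cycle B xs))"
proof -
  interpret bicyclic_signed B "signed_adj B"
    using assms(1) by unfold_locales (auto simp: bicyclic_signed_graph_def)
  let ?w = "signed_adj B"
  have n: "n = card (verts B)" using assms(3) by (simp add: graph_order_def)
  obtain xs where xs: "is_cycle (underlying_graph B) xs" "\<not> balanced_cycle B xs"
    using assms(2) by (auto simp: balanced_def)
  then have closed: "closed_sign ?w xs = - 1"
    using cycle_sign_cases cycle_sign_eq_closed_sign by (auto simp: balanced_cycle_def)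
  show ?thesis
  proof (cases "nullity B + 4 \<le> card (verts B)")
    \<comment> \<open>Both sides of the equivalence fail. For the four vertices of Theta(2, 2, 1)
      the nullity would be 0, while two negative triangles make it at least 1.\<close>
    case True
    have False if Theta: "is_Theta (underlying_graph B) 2 2 1"
      and neg: "\<And>xs. is_triangle (underlying_graph B) xs \<Longrightarrow> unbalanced_cycle B xs"
    proof -
      obtain p q r x where d: "distinct [p, q, r, x]" and V: "verts B = {p, q, r, x}"
        and E: "edges B = {{p, q}, {p, r}, {q, r}, {p, x}, {q, x}}"
        by (rule is_Theta_221E[OF Theta]) simp
      have nz: "?w p q \<noteq> 0" "?w p r \<noteq> 0" "?w q r \<noteq> 0" "?w p x \<noteq> 0" "?w q x \<noteq> 0"
        by (simp_all add: w_nonzero_iff E)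
      have rx: "?w r x = 0" using w_nonzero_iff[of r x] d by (auto simp: E doubleton_eq_iff)
      have tri: "?w p q * ?w q s * ?w p s = - 1" if "?w q s \<noteq> 0" "?w p s \<noteq> 0" for s
        using neg[of "[p, q, s]"] cycle_sign_triangle[of p q s] is_triangle_iff[of "[p, q, s]"] nz(1) that
        by (simp add: unbalanced_cycle_def)
      \<comment> \<open>The two triangle signs are equal; the common edge cancels.\<close>
      have "?w p r * ?w q x = ?w q r * ?w p x"
        using tri[of r] tri[of x] nz w_cases[of p q] w_cases[of p r] w_cases[of q r] w_cases[of p x] w_cases[of q x]
        by auto
      then have "1 \<le> nullity B" using nullity_diamond_pos[OF d V rx nz(4)] by simp
      then show False using True V d by simp
    qed
    then show ?thesis using True n by auto
  next
    case False
    obtain a b c where abc: "?w a b * ?w b c * ?w a c = - 1"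
      using negative_triangle_exists[OF False _ _ closed] xs(1) by (auto simp: is_cycle_def is_path_def)
    then have "nullity B + 3 \<le> card (verts B)" by (intro nullity_triangle[of a b c]) auto
    \<comment> \<open>The triangle bound and the case assumption leave only this value, so it
      remains to identify the graph.\<close>
    then have eq: "int (nullity B) = int n - 3" using False n by simp
    obtain p q r x where d: "distinct [p, q, r, x]"
      and neg: "?w p q * ?w p r * ?w q r = - 1" "?w p q * ?w p x * ?w q x = - 1"
      using obtain_negative_diamond[OF False abc] by blast
    then have nz: "?w p q \<noteq> 0" "?w p r \<noteq> 0" "?w q r \<noteq> 0" "?w p x \<noteq> 0" "?w q x \<noteq> 0" by auto
    note VE = diamond_exhausts_graph[OF False d nz]
    have "?w r x = 0" using w_nonzero_iff[of r x] d by (auto simp: VE(2) doubleton_eq_iff)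
    then have "unbalanced_cycle B ys" if "is_triangle (underlying_graph B) ys" for ys
      using diamond_triangles_negative[OF VE(1) _ neg that] by simp
    moreover have "is_Theta (underlying_graph B) 2 2 1"
      by (rule is_Theta_221I[OF d]) (simp_all add: VE)
    ultimately show ?thesis using eq by simp
  qed
qed

end
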